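(* Let $\Phi$, $\mu$, $\varphi$, $V$ be as in the standing assumption (see context), and suppose $\varphi\in\mathcal Z_{C_1}(\mathbb R^d)$ for some $C_1\in(0,1)$, with associated function $L_\varphi$. Suppose that there exist constants $C_\mu,\eta>0$ and $\alpha\in(0,2]$ such that $\mu(t)\sim C_\mu t^{-1-\frac\alpha2}e^{-\eta t}$ as $t\to\infty$. If, furthermore, there exist (1) $C_2,C_3,M_1>0$ and $\kappa\in\left(0,\frac{d+\alpha}2\right)$ such that $C_2|x|^{-2\kappa}\le\varphi(x)\le C_3|x|^{-2\kappa}$ for $x\in B^c_{M_1}(0)$, (2) $M_2,C_4>0$ such that $L_\varphi(x)\le C_4|x|^{-(2\kappa+2)}$ for $x\in B^c_{M_2}(0)$, then $V(x)=O(|x|^{-2})$.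
   Context: Notation: $B_r(a)$ is the open ball in $\mathbb R^d$, $B_r^c(a)$ its complement; $D_hf(x)=f(x+h)-2f(x)+f(x-h)$. $V(x)=O(g(x))$ means there exist $R,C>0$ with $|V(x)|\le Cg(x)$ for $|x|\ge R$; $f\sim g$ means the ratio tends to $1$. $\Phi$ is a complete Bernstein function with Lévy pair $(0,\mu)$: $\Phi(u)=\int_0^\infty(1-e^{-ut})\mu(t)\,dt$ with $\mu:(0,\infty)\to[0,\infty)$ completely monotone and $\int_0^\infty\min(1,t)\mu(t)\,dt<\infty$. The jump kernel is $j(r)=(4\pi)^{-d/2}\int_0^\infty t^{-d/2}e^{-r^2/(4t)}\mu(t)\,dt$, $r>0$. $\Phi(-\Delta)$ is the operator on $L^2(\mathbb R^d)$ with Fourier multiplier $\Phi(|y|^2)$. Standing assumption: $V:\mathbb R^d\to\mathbb R$ is a potential, $H=\Phi(-\Delta)+V$, and $\varphi\in L^2(\mathbb R^d)\cap L^\infty(\mathbb R^d)$, $\varphi>0$, satisfies $H\varphi=0$. The potential is understood through the pointwise expression $V(x)=-\frac{1}{\varphi(x)}\Phi(-\Delta)\varphi(x)=\frac{1}{2\varphi(x)}\int_{\mathbb R^d}D_h\varphi(x)\,j(|h|)\,dh$. Space: for $C\in(0,1)$, $\mathcal Z_C(\mathbb R^d)$ is the set of $f\in L^\infty(\mathbb R^d)$ for which there exist $M_f>0$ and $L_f\in L^\infty(B^c_{M_f}(0))$ such that $|D_hf(x)|\le L_f(x)|h|^2$ for all $x\in B^c_{M_f}(0)$ and $h\in B_{C|x|}(0)$.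 *)

theory Defs
  imports "HOL-Analysis.Analysis" "HOL-Library.Landau_Symbols"
begin

definition completely_monotone :: "(real \<Rightarrow> real) \<Rightarrow> bool" where
  "completely_monotone f \<longleftrightarrow>
     (\<forall>n. \<forall>t>0. (deriv ^^ n) f field_differentiable at t \<and> 0 \<le> (-1) ^ n * (deriv ^^ n) f t)"

text \<open>Complete Bernstein functions with Levy pair \<open>(0, \<mu>)\<close>: no killing and no drift, and a
  Levy measure with completely monotone density \<open>\<mu>\<close>.  The values of \<open>\<Phi>\<close> on the negative axis
  and of \<open>\<mu>\<close> outside the open half-line are irrelevant.\<close>

definition complete_Bernstein :: "(real \<Rightarrow> real) \<Rightarrow> (real \<Rightarrow> real) \<Rightarrow> bool" where
  "complete_Bernstein \<Phi> \<mu> \<longleftrightarrow>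
     completely_monotone \<mu> \<and>
     set_integrable lborel {0<..} (\<lambda>t. min 1 t * \<mu> t) \<and>
     (\<forall>u\<ge>0. \<Phi> u = (LINT t:{0<..}|lborel. (1 - exp (- (u * t))) * \<mu> t))"

definition jump_kernel :: "nat \<Rightarrow> (real \<Rightarrow> real) \<Rightarrow> real \<Rightarrow> real" where
  "jump_kernel d \<mu> r =
     (4 * pi) powr (- real d / 2) *
     (LINT t:{0<..}|lborel. t powr (- real d / 2) * exp (- r\<^sup>2 / (4 * t)) * \<mu> t)"

definition second_diff :: "('a::euclidean_space \<Rightarrow> real) \<Rightarrow> 'a \<Rightarrow> 'a \<Rightarrow> real" where
  "second_diff f h x = f (x + h) - 2 * f x + f (x - h)"

definition L2 :: "('a::euclidean_space \<Rightarrow> 'b::{banach, second_countable_topology}) set" where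
  "L2 = {f \<in> borel_measurable lebesgue. integrable lebesgue (\<lambda>x. (norm (f x))\<^sup>2)}"

definition Linfty_on :: "'a::euclidean_space set \<Rightarrow> ('a \<Rightarrow> real) set" where
  "Linfty_on S = {f \<in> borel_measurable (lebesgue_on S). \<exists>B. AE x in lebesgue_on S. \<bar>f x\<bar> \<le> B}"

text \<open>\<open>F\<close> is (a representative of) the Fourier--Plancherel transform of \<open>f\<close>: the limit in the
  square mean of the Fourier integrals of \<open>f\<close> over balls of growing radius.\<close>

definition has_fourier_L2 ::
    "('a::euclidean_space \<Rightarrow> complex) \<Rightarrow> ('a \<Rightarrow> complex) \<Rightarrow> bool" where
  "has_fourier_L2 f F \<longleftrightarrow>
     f \<in> L2 \<and> F \<in> L2 \<and>
     (\<lambda>n::nat. \<integral>\<^sup>+ y. ennreal ((norm (F y -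
           of_real ((2 * pi) powr (- real DIM('a) / 2)) *
           (LINT x:cball 0 (real n)|lebesgue. cis (- (x \<bullet> y)) * f x)))\<^sup>2) \<partial>lebesgue)
       \<longlonglongrightarrow> 0"

text \<open>\<open>has_Phi_Laplacian \<Phi> f g\<close> means that \<open>f\<close> lies in the domain of the operator \<open>\<Phi>(-\<Delta>)\<close>
  with Fourier multiplier \<open>\<Phi>(\<bar>y\<bar>\<^sup>2)\<close>, and that \<open>\<Phi>(-\<Delta>) f = g\<close> in the sense of square integrable
  functions (that is, almost everywhere).  The domain condition is contained in the requirement
  that the transform of \<open>g\<close> be square integrable.\<close>

definition has_Phi_Laplacian ::
    "(real \<Rightarrow> real) \<Rightarrow> ('a::euclidean_space \<Rightarrow> real) \<Rightarrow> ('a \<Rightarrow> real) \<Rightarrow> bool" where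
  "has_Phi_Laplacian \<Phi> f g \<longleftrightarrow>
     (\<exists>F. has_fourier_L2 (\<lambda>x. complex_of_real (f x)) F \<and>
          has_fourier_L2 (\<lambda>x. complex_of_real (g x))
            (\<lambda>y. complex_of_real (\<Phi> ((norm y)\<^sup>2)) * F y))"

text \<open>\<open>\<phi>\<close> is a positive, bounded, square integrable solution of \<open>H \<phi> = 0\<close> for
  \<open>H = \<Phi>(-\<Delta>) + V\<close>.  The operator equation determines \<open>V\<close> only almost everywhere; the last
  conjunct fixes its values through the pointwise expression for \<open>-\<Phi>(-\<Delta>)\<phi> / \<phi>\<close>, at all points
  where the integral converges absolutely, and says nothing about \<open>V\<close> elsewhere.\<close>

definition zero_energy_eigenfunction ::
    "(real \<Rightarrow> real) \<Rightarrow> (real \<Rightarrow> real) \<Rightarrow> ('a::euclidean_space \<Rightarrow> real) \<Rightarrow> ('a \<Rightarrow> real) \<Rightarrow> bool" where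
  "zero_energy_eigenfunction \<Phi> \<mu> V \<phi> \<longleftrightarrow>
     \<phi> \<in> L2 \<and> \<phi> \<in> Linfty_on UNIV \<and> (\<forall>x. 0 < \<phi> x) \<and>
     has_Phi_Laplacian \<Phi> \<phi> (\<lambda>x. - (V x * \<phi> x)) \<and>
     (\<forall>x. integrable lebesgue (\<lambda>h. second_diff \<phi> h x * jump_kernel DIM('a) \<mu> (norm h)) \<longrightarrow>
        V x = 1 / (2 * \<phi> x) *
          (LINT h|lebesgue. second_diff \<phi> h x * jump_kernel DIM('a) \<mu> (norm h)))"

definition Z_bound ::
    "real \<Rightarrow> ('a::euclidean_space \<Rightarrow> real) \<Rightarrow> real \<Rightarrow> ('a \<Rightarrow> real) \<Rightarrow> bool" where
  "Z_bound C f M L \<longleftrightarrow>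
     0 < M \<and> L \<in> Linfty_on (- ball 0 M) \<and>
     (\<forall>x \<in> - ball 0 M. \<forall>h \<in> ball 0 (C * norm x). \<bar>second_diff f h x\<bar> \<le> L x * (norm h)\<^sup>2)"

definition Z_space :: "real \<Rightarrow> ('a::euclidean_space \<Rightarrow> real) set" where
  "Z_space C = {f \<in> Linfty_on UNIV. \<exists>M L. Z_bound C f M L}"

end

theory Submission
  imports Defs "HOL-Probability.Distributions"
begin

text \<open>Put \<open>r = \<bar>x\<bar>\<close> and split the integral of \<open>D\<^sub>h\<phi>(x) j(\<bar>h\<bar>)\<close> at \<open>\<bar>h\<bar> = C\<^sub>1 r\<close>.  On the ball the
  \<open>\<Z>\<close>-condition gives \<open>\<bar>D\<^sub>h\<phi>(x)\<bar> \<le> C\<^sub>4 r\<^bsup>-2\<kappa>-2\<^esup> \<bar>h\<bar>\<^sup>2\<close>, so that part is at most a multiple of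
  \<open>r\<^bsup>-2\<kappa>-2\<^esup>\<close> once \<open>\<integral> \<bar>h\<bar>\<^sup>2 j(\<bar>h\<bar>) dh\<close> is finite.  Outside the ball \<open>D\<^sub>h\<phi>(x)\<close> is only known to be
  essentially bounded, but there \<open>1 \<le> (\<bar>h\<bar> / (C\<^sub>1 r))\<^bsup>2m\<^esup>\<close>, and Markov's inequality bounds that
  part by a multiple of \<open>r\<^bsup>-2m\<^esup>\<close> once \<open>\<integral> \<bar>h\<bar>\<^bsup>2m\<^esup> j(\<bar>h\<bar>) dh\<close> is finite; choose \<open>m \<ge> \<kappa> + 1\<close>.
  Dividing by \<open>\<phi>(x) \<ge> C\<^sub>2 r\<^bsup>-2\<kappa>\<^esup>\<close> leaves \<open>O(r\<^bsup>-2\<^esup>)\<close>.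

  It remains to see that all even moments of positive order of \<open>j\<close> are finite
  (\<open>jump_kernel_even_moment\<close>).  Since \<open>j\<close> is a mixture of heat kernels with weight \<open>\<mu>\<close>, Tonelli's
  theorem and the scaling of Gaussian moments turn the moment of order \<open>2m\<close> into a constant times
  \<open>\<integral> t\<^sup>m \<mu>(t) dt\<close>.  This converges at \<open>0\<close> because \<open>\<mu>\<close> is a Levy density and \<open>m \<ge> 1\<close>, and at
  infinity because of the factor \<open>exp(-\<eta>t)\<close> in the asymptotics of \<open>\<mu>\<close>.\<close>

section \<open>Gaussian moments\<close>

text \<open>The price of absorbing a power of \<open>s\<close> into half of the Gaussian exponent \<open>s\<^sup>2 / 4\<close>.  The
  exponential series in \<open>s\<^sup>2\<close> bounds even powers, and \<open>s\<^sup>n\<close> is compared with \<open>1 + s\<^bsup>2n\<^esup>\<close>.\<close>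

lemma power_le_const_times_exp:
  fixes s :: real
  assumes "0 \<le> s"
  shows "s ^ n \<le> (1 + 8 ^ n * fact n) * exp (s\<^sup>2 / 8)"
proof -
  have "(s\<^sup>2 / 8) ^ n / fact n \<le> exp (s\<^sup>2 / 8)"
  proof -
    define y where "y = s\<^sup>2 / 8"
    have "0 \<le> y" by (simp add: y_def)
    have y: "(\<lambda>k. y ^ k /\<^sub>R fact k) sums exp y" by (rule exp_converges)
    have "(\<Sum>k\<in>{n}. y ^ k /\<^sub>R fact k) \<le> exp y"
      using y \<open>0 \<le> y\<close> by (subst sums_unique[OF y], intro sum_le_suminf) (auto dest: sums_summable)
    then have "y ^ n / fact n \<le> exp y" by (simp add: divide_inverse_commute)
    then show ?thesis by (simp only: y_def)
  qed
  then have "(s\<^sup>2) ^ n \<le> 8 ^ n * fact n * exp (s\<^sup>2 / 8)"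
    by (simp add: power_divide field_simps)
  moreover have "s ^ n \<le> 1 + (s\<^sup>2) ^ n"
  proof -
    have "0 \<le> (s ^ n - 1)\<^sup>2 + (s ^ n) * (s ^ n)" by simp
    moreover have "(s\<^sup>2) ^ n = s ^ n * s ^ n"
      by (simp add: power2_eq_square power_mult_distrib)
    ultimately show ?thesis by (simp add: power2_eq_square algebra_simps)
  qed
  moreover have "1 \<le> exp (s\<^sup>2 / 8)" by simp
  ultimately have "s ^ n \<le> exp (s\<^sup>2 / 8) + 8 ^ n * fact n * exp (s\<^sup>2 / 8)" by linarith
  then show ?thesis by (simp only: distrib_right mult_1_left)
qed

lemma gaussian_nn_integral_finite:
  "(\<integral>\<^sup>+u. ennreal (exp (- (norm u)\<^sup>2 / 8)) \<partial>(lborel :: 'a::euclidean_space measure)) < \<infinity>"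
proof -
  have one: "(\<integral>\<^sup>+x. ennreal (exp (- x\<^sup>2 / 8)) \<partial>(lborel :: real measure)) < \<infinity>"
  proof -
    have "(\<lambda>x. exp (- x\<^sup>2 / 8)) = (\<lambda>x::real. sqrt (8 * pi) * normal_density 0 2 x)"
      by (auto simp: normal_density_def fun_eq_iff)
    then have "integrable lborel (\<lambda>x::real. exp (- x\<^sup>2 / 8))"
      by simp
    then show ?thesis by (simp add: integrable_iff_bounded)
  qed
  have "ennreal (exp (- (norm u)\<^sup>2 / 8)) = (\<Prod>b\<in>Basis. ennreal (exp (- (u \<bullet> b)\<^sup>2 / 8)))" for u :: 'a
  proof -
    have "(norm u)\<^sup>2 = (\<Sum>b\<in>Basis. (u \<bullet> b)\<^sup>2)"
      unfolding power2_norm_eq_inner by (subst euclidean_inner) (simp add: power2_eq_square)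
    then have "exp (- (norm u)\<^sup>2 / 8) = exp (\<Sum>b\<in>Basis. - (u \<bullet> b)\<^sup>2 / 8)"
      by (simp add: sum_negf sum_divide_distrib)
    also have "\<dots> = (\<Prod>b\<in>Basis. exp (- (u \<bullet> b)\<^sup>2 / 8))" by (simp add: exp_sum)
    finally show ?thesis by (simp add: prod_ennreal)
  qed
  then have "(\<integral>\<^sup>+u. ennreal (exp (- (norm u)\<^sup>2 / 8)) \<partial>(lborel :: 'a measure))
      = (\<integral>\<^sup>+u. (\<Prod>b\<in>Basis. ennreal (exp (- (u \<bullet> b)\<^sup>2 / 8))) \<partial>(lborel :: 'a measure))"
    by simp
  also have "\<dots> = (\<Prod>b\<in>(Basis::'a set). \<integral>\<^sup>+x. ennreal (exp (- x\<^sup>2 / 8)) \<partial>lborel)"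
    by (rule nn_integral_lborel_prod) auto
  also have "\<dots> < \<infinity>" using one by (simp add: power_less_top_ennreal)
  finally show ?thesis .
qed

lemma gaussian_moment_finite:
  "(\<integral>\<^sup>+u. ennreal (norm u ^ n * exp (- (norm u)\<^sup>2 / 4)) \<partial>(lborel :: 'a::euclidean_space measure)) < \<infinity>"
proof -
  define K :: real where "K = 1 + 8 ^ n * fact n"
  have K0: "0 \<le> K" by (simp add: K_def)
  have "norm u ^ n * exp (- (norm u)\<^sup>2 / 4) \<le> K * exp (- (norm u)\<^sup>2 / 8)" for u :: 'a
  proof -
    have "norm u ^ n * exp (- (norm u)\<^sup>2 / 4)
        \<le> (K * exp ((norm u)\<^sup>2 / 8)) * exp (- (norm u)\<^sup>2 / 4)"
      unfolding K_def by (intro mult_right_mono power_le_const_times_exp) auto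
    also have "\<dots> = K * exp (- (norm u)\<^sup>2 / 8)"
      by (simp add: mult.assoc exp_add[symmetric])
    finally show ?thesis .
  qed
  then have "(\<integral>\<^sup>+u. ennreal (norm u ^ n * exp (- (norm u)\<^sup>2 / 4)) \<partial>(lborel :: 'a measure))
      \<le> (\<integral>\<^sup>+u. ennreal K * ennreal (exp (- (norm u)\<^sup>2 / 8)) \<partial>(lborel :: 'a measure))"
    using K0 by (intro nn_integral_mono) (simp add: ennreal_mult[symmetric] ennreal_leI)
  also have "\<dots> = ennreal K * (\<integral>\<^sup>+u. ennreal (exp (- (norm u)\<^sup>2 / 8)) \<partial>(lborel :: 'a measure))"
    by (rule nn_integral_cmult) simp
  also have "\<dots> < \<infinity>" using gaussian_nn_integral_finite[where 'a='a] by (simp add: ennreal_mult_less_top)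
  finally show ?thesis .
qed

text \<open>The substitution \<open>h = \<surd>t u\<close>: the power \<open>t\<^bsup>d/2\<^esup>\<close> of its Jacobian is what cancels the
  normalisation of the heat kernel.\<close>

lemma gaussian_moment_scaling:
  assumes t: "0 < (t::real)"
  shows "(\<integral>\<^sup>+h. ennreal (norm h ^ (2 * m) * exp (- (norm h)\<^sup>2 / (4 * t))) \<partial>(lborel :: 'a::euclidean_space measure))
    = ennreal (t powr (real DIM('a) / 2) * t ^ m) *
      (\<integral>\<^sup>+u. ennreal (norm u ^ (2 * m) * exp (- (norm u)\<^sup>2 / 4)) \<partial>(lborel :: 'a measure))"
proof -
  let ?f = "\<lambda>h::'a. ennreal (norm h ^ (2 * m) * exp (- (norm h)\<^sup>2 / (4 * t)))"
  let ?g = "\<lambda>u::'a. ennreal (norm u ^ (2 * m) * exp (- (norm u)\<^sup>2 / 4))"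
  have c: "sqrt t \<noteq> 0" using t by simp
  have pow: "sqrt t ^ DIM('a) = t powr (real DIM('a) / 2)"
    using t by (simp add: powr_half_sqrt[symmetric] powr_realpow[symmetric] powr_powr)
  have scale: "?f (0 + sqrt t *\<^sub>R u) = ennreal (t ^ m) * ?g u" for u
  proof -
    have "norm (sqrt t *\<^sub>R u) ^ (2 * m) = t ^ m * norm u ^ (2 * m)"
      using t by (simp add: power_mult_distrib power_mult)
    moreover have "(norm (sqrt t *\<^sub>R u))\<^sup>2 / (4 * t) = (norm u)\<^sup>2 / 4"
      using t by (simp add: power_mult_distrib)
    ultimately show ?thesis using t by (simp add: ennreal_mult[symmetric] mult.assoc)
  qed
  have "(\<integral>\<^sup>+h. ?f h \<partial>lborel) = (\<integral>\<^sup>+h. ?f h \<partial>density (distr lborel borel (\<lambda>u. 0 + sqrt t *\<^sub>R u)) (\<lambda>_. \<bar>sqrt t\<bar>^DIM('a)))"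
    using lborel_affine[OF c, where t="0::'a"] by simp
  also have "\<dots> = ennreal (sqrt t ^ DIM('a)) * (\<integral>\<^sup>+u. ?f (0 + sqrt t *\<^sub>R u) \<partial>lborel)"
    using t by (simp add: nn_integral_density nn_integral_distr nn_integral_cmult)
  also have "\<dots> = ennreal (sqrt t ^ DIM('a)) * (ennreal (t ^ m) * (\<integral>\<^sup>+u. ?g u \<partial>lborel))"
    unfolding scale by (subst nn_integral_cmult) auto
  also have "\<dots> = ennreal (t powr (real DIM('a) / 2) * t ^ m) * (\<integral>\<^sup>+u. ?g u \<partial>lborel)"
    unfolding pow using t by (simp add: ennreal_mult mult.assoc)
  finally show ?thesis .
qed

section \<open>Moments of the jump kernel\<close>

lemma completely_monotone_nonneg:
  assumes "completely_monotone \<mu>" "0 < t"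
  shows "0 \<le> \<mu> t"
  using assms unfolding completely_monotone_def by (auto dest: spec[where x=0])

lemma Levy_density_measurable:
  assumes "complete_Bernstein \<Phi> \<mu>"
  shows "(\<lambda>t. indicator {0<..} t * \<mu> t) \<in> borel_measurable borel"
proof -
  have "(\<lambda>t. indicator {0<..} t *\<^sub>R (min 1 t * \<mu> t)) \<in> borel_measurable borel"
    using assms borel_measurable_integrable
    unfolding complete_Bernstein_def set_integrable_def by fastforce
  then have "(\<lambda>t. (indicator {0<..} t *\<^sub>R (min 1 t * \<mu> t)) / min 1 t) \<in> borel_measurable borel"
    by measurable
  also have "(\<lambda>t. (indicator {0<..} t *\<^sub>R (min 1 t * \<mu> t)) / min 1 t)
      = (\<lambda>t. indicator {0<..} t * \<mu> t)"
    by (auto simp: fun_eq_iff indicator_def)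
  finally show ?thesis .
qed

text \<open>Up to a fixed time \<open>T\<close> the weight \<open>t\<^sup>m\<close> is dominated by \<open>T\<^sup>m min(1,t)\<close>, which the
  Levy condition controls; beyond \<open>T\<close> the asymptotics compare \<open>t\<^sup>m \<mu>(t)\<close> with a moment of the
  exponential distribution, as the factor \<open>t\<^bsup>-1-\<alpha>/2\<^esup>\<close> is at most \<open>1\<close> there.\<close>

lemma Levy_density_moment_finite:
  assumes cB: "complete_Bernstein \<Phi> \<mu>"
    and pos: "0 < C" "0 < \<eta>" "0 < \<alpha>"
    and asym: "\<mu> \<sim>[at_top] (\<lambda>t. C * t powr (- 1 - \<alpha> / 2) * exp (- (\<eta> * t)))"
    and m: "1 \<le> m"
  shows "(\<integral>\<^sup>+t. ennreal (t ^ m * (indicator {0<..} t * \<mu> t)) \<partial>lborel) < \<infinity>"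
proof -
  note [measurable] = Levy_density_measurable[OF cB]
  have nonneg: "0 \<le> \<mu> t" if "0 < t" for t
    using cB that completely_monotone_nonneg by (auto simp: complete_Bernstein_def)
  have "eventually (\<lambda>t. \<bar>\<mu> t\<bar> \<le> 2 * \<bar>C * t powr (- 1 - \<alpha> / 2) * exp (- (\<eta> * t))\<bar>) at_top"
    using asymp_equiv_imp_eventually_le[OF asym, of 2] by simp
  then obtain T0 where T0: "\<And>t. T0 \<le> t \<Longrightarrow> \<bar>\<mu> t\<bar> \<le> 2 * \<bar>C * t powr (- 1 - \<alpha> / 2) * exp (- (\<eta> * t))\<bar>"
    by (auto simp: eventually_at_top_linorder)
  define T where "T = max 1 T0"
  have T1: "1 \<le> T" by (simp add: T_def)
  have large: "\<mu> t \<le> 2 * C * exp (- \<eta> * t)" if "T \<le> t" for t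
  proof -
    have t: "1 \<le> t" "T0 \<le> t" using that by (auto simp: T_def)
    have "t powr (- 1 - \<alpha> / 2) \<le> t powr 0" using t pos by (intro powr_mono) auto
    then have "t powr (- 1 - \<alpha> / 2) \<le> 1" using t by simp
    then have "C * t powr (- 1 - \<alpha> / 2) * exp (- (\<eta> * t)) \<le> C * 1 * exp (- (\<eta> * t))"
      using pos by (intro mult_right_mono mult_left_mono) auto
    moreover have "\<mu> t \<le> 2 * (C * t powr (- 1 - \<alpha> / 2) * exp (- (\<eta> * t)))"
      using T0[OF t(2)] pos by (simp add: abs_mult)
    ultimately show ?thesis by simp
  qed
  let ?I = "\<lambda>t. indicator {0<..} t * \<mu> t"
  \<comment> \<open>The division by \<open>\<eta>\<close> removes the normalising factor of the exponential density.\<close>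
  let ?K = "2 * C / \<eta>"
  have bound: "t ^ m * ?I t \<le> T ^ m * (min 1 t * ?I t) + ?K * (erlang_density 0 \<eta> t * t ^ m)" for t
  proof (cases "0 < t")
    case False
    then show ?thesis using pos m
      by (cases "t = 0") (auto simp: erlang_density_def)
  next
    case True
    have *: "t ^ m \<le> T ^ m * min 1 t" if "t \<le> T"
    proof (cases "t \<le> 1")
      case True
      with \<open>0 < t\<close> m have "t ^ m \<le> t ^ 1" by (intro power_decreasing) auto
      also have "\<dots> \<le> T ^ m * t" using T1 \<open>0 < t\<close> by simp
      finally show ?thesis using True by simp
    next
      case False
      then show ?thesis using that by (simp add: power_mono)
    qed
    have e: "0 \<le> ?K * (erlang_density 0 \<eta> t * t ^ m)" using pos True by simp
    show ?thesis
    proof (cases "t \<le> T")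
      case le: True
      have "t ^ m * \<mu> t \<le> (T ^ m * min 1 t) * \<mu> t"
        using *[OF le] nonneg[OF True] by (rule mult_right_mono)
      then show ?thesis using e True by (simp add: mult.assoc)
    next
      case False
      then have "t ^ m * \<mu> t \<le> t ^ m * (2 * C * exp (- \<eta> * t))"
        using True large[of t] by (intro mult_left_mono) auto
      also have "\<dots> = ?K * (erlang_density 0 \<eta> t * t ^ m)"
        using True pos by (simp add: erlang_density_def)
      finally show ?thesis using True T1 nonneg[OF True] by (simp add: add_increasing)
    qed
  qed
  have n1: "0 \<le> min 1 t * ?I t" for t using nonneg[of t] by (auto simp: indicator_def)
  have n2: "0 \<le> erlang_density 0 \<eta> t * t ^ m" for t
    using pos by (auto simp: erlang_density_def)
  have "(\<integral>\<^sup>+t. ennreal (t ^ m * ?I t) \<partial>lborel)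
      \<le> (\<integral>\<^sup>+t. ennreal (T ^ m) * ennreal (min 1 t * ?I t) +
              ennreal ?K * ennreal (erlang_density 0 \<eta> t * t ^ m) \<partial>lborel)"
  proof (intro nn_integral_mono)
    fix t
    show "ennreal (t ^ m * ?I t) \<le> ennreal (T ^ m) * ennreal (min 1 t * ?I t) +
              ennreal ?K * ennreal (erlang_density 0 \<eta> t * t ^ m)"
      using bound[of t] T1 pos n1[of t] n2[of t]
      by (simp add: ennreal_mult[symmetric] ennreal_plus[symmetric] ennreal_leI del: ennreal_plus)
  qed
  also have "\<dots> = ennreal (T ^ m) * (\<integral>\<^sup>+t. ennreal (min 1 t * ?I t) \<partial>lborel) +
      ennreal ?K * (\<integral>\<^sup>+t. ennreal (erlang_density 0 \<eta> t * t ^ m) \<partial>lborel)"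
    by (simp add: nn_integral_add nn_integral_cmult)
  also have "\<dots> < \<infinity>"
  proof -
    have "integrable lborel (\<lambda>t. min 1 t * ?I t)"
      using cB by (simp add: complete_Bernstein_def set_integrable_def mult.left_commute)
    then have "(\<integral>\<^sup>+t. ennreal (norm (min 1 t * ?I t)) \<partial>lborel) < \<infinity>"
      unfolding integrable_iff_bounded by blast
    then have "(\<integral>\<^sup>+t. ennreal (min 1 t * ?I t) \<partial>lborel) < \<infinity>"
      using n1 by simp
    moreover have "(\<integral>\<^sup>+t. ennreal (erlang_density 0 \<eta> t * t ^ m) \<partial>lborel) < \<infinity>"
      using pos by (simp add: nn_integral_erlang_ith_moment del: times_divide_eq_right)
    ultimately show ?thesis by (simp add: ennreal_mult_less_top)
  qed
  finally show ?thesis .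
qed

lemma jump_kernel_nonneg:
  assumes "complete_Bernstein \<Phi> \<mu>"
  shows "0 \<le> jump_kernel d \<mu> r"
proof -
  have "0 \<le> \<mu> t" if "0 < t" for t
    using assms that completely_monotone_nonneg by (auto simp: complete_Bernstein_def)
  then show ?thesis
    unfolding jump_kernel_def set_lebesgue_integral_def
    by (intro mult_nonneg_nonneg integral_nonneg) (auto simp: indicator_def)
qed

lemma jump_kernel_eq:
  "jump_kernel d \<mu> r = (4 * pi) powr (- real d / 2) *
     (\<integral>t. t powr (- real d / 2) * exp (- r\<^sup>2 / (4 * t)) * (indicator {0<..} t * \<mu> t) \<partial>lborel)"
  unfolding jump_kernel_def set_lebesgue_integral_def
  by (auto intro!: arg_cong[where f="\<lambda>z. _ * z"] Bochner_Integration.integral_cong)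

lemma jump_kernel_measurable:
  assumes "complete_Bernstein \<Phi> \<mu>"
  shows "jump_kernel d \<mu> \<in> borel_measurable borel"
proof -
  note [measurable] = Levy_density_measurable[OF assms]
  have [measurable]: "(\<lambda>(r, t). t powr (- real d / 2) * exp (- r\<^sup>2 / (4 * t)) * (indicator {0<..} t * \<mu> t))
      \<in> borel_measurable (borel \<Otimes>\<^sub>M lborel)"
    by measurable
  show ?thesis
    unfolding jump_kernel_eq[abs_def] by measurable
qed

text \<open>An inequality rather than an equation: at \<open>r = 0\<close> the integral may diverge, and then the
  Bochner integral has the value \<open>0\<close>.\<close>

lemma jump_kernel_le_nn_integral:
  assumes "complete_Bernstein \<Phi> \<mu>"
  shows "ennreal (jump_kernel d \<mu> r) \<le> ennreal ((4 * pi) powr (- real d / 2)) *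
     (\<integral>\<^sup>+t. ennreal (t powr (- real d / 2) * exp (- r\<^sup>2 / (4 * t)) * (indicator {0<..} t * \<mu> t)) \<partial>lborel)"
proof -
  note [measurable] = Levy_density_measurable[OF assms]
  let ?f = "\<lambda>t. t powr (- real d / 2) * exp (- r\<^sup>2 / (4 * t)) * (indicator {0<..} t * \<mu> t)"
  have "0 \<le> \<mu> t" if "0 < t" for t
    using assms that completely_monotone_nonneg by (auto simp: complete_Bernstein_def)
  then have nn: "0 \<le> ?f t" for t by (auto simp: indicator_def)
  have "ennreal (\<integral>t. ?f t \<partial>lborel) \<le> (\<integral>\<^sup>+t. ennreal (?f t) \<partial>lborel)"
    using nn by (subst integral_eq_nn_integral) (auto simp: ennreal_enn2real_if)
  then show ?thesis
    unfolding jump_kernel_eq by (simp add: ennreal_mult' mult_left_mono)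
qed

text \<open>Tonelli's theorem exchanges the integrals over \<open>h\<close> and \<open>t\<close>.  The inner Gaussian moment is
  \<open>G t\<^bsup>d/2 + m\<^esup>\<close>, so against the factor \<open>t\<^bsup>-d/2\<^esup>\<close> of the heat kernel only \<open>t\<^sup>m\<close> remains.\<close>

lemma jump_kernel_even_moment:
  assumes cB: "complete_Bernstein \<Phi> \<mu>"
    and fin: "(\<integral>\<^sup>+t. ennreal (t ^ m * (indicator {0<..} t * \<mu> t)) \<partial>lborel) < \<infinity>"
  shows "integrable lebesgue (\<lambda>h::'a::euclidean_space. norm h ^ (2 * m) * jump_kernel DIM('a) \<mu> (norm h))"
proof -
  note [measurable] = Levy_density_measurable[OF cB] jump_kernel_measurable[OF cB]
  let ?d = "real DIM('a)"
  let ?I = "\<lambda>t. indicator {0<..} t * \<mu> t"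
  define c where "c = ennreal ((4 * pi) powr (- ?d / 2))"
  define G where "G = (\<integral>\<^sup>+u. ennreal (norm u ^ (2 * m) * exp (- (norm u)\<^sup>2 / 4)) \<partial>(lborel :: 'a measure))"
  have nonneg: "0 \<le> ?I t" for t
    using cB completely_monotone_nonneg by (auto simp: complete_Bernstein_def indicator_def)
  let ?k = "\<lambda>(h::'a) t. norm h ^ (2 * m) *
      (t powr (- ?d / 2) * exp (- (norm h)\<^sup>2 / (4 * t)) * ?I t)"
  have inner: "(\<integral>\<^sup>+h. ennreal (?k h t) \<partial>lborel) = G * ennreal (t ^ m * ?I t)" for t
  proof (cases "0 < t")
    case False
    then show ?thesis by simp
  next
    case True
    let ?a = "t powr (- ?d / 2) * ?I t"
    have a: "0 \<le> ?a" using nonneg[of t] by simp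
    have "(\<integral>\<^sup>+h. ennreal (?k h t) \<partial>lborel)
        = (\<integral>\<^sup>+h. ennreal ?a * ennreal (norm h ^ (2 * m) * exp (- (norm h)\<^sup>2 / (4 * t))) \<partial>(lborel :: 'a measure))"
      by (intro nn_integral_cong, subst ennreal_mult'[OF a, symmetric]) (simp add: mult_ac)
    also have "\<dots> = ennreal ?a * (\<integral>\<^sup>+h. ennreal (norm h ^ (2 * m) * exp (- (norm h)\<^sup>2 / (4 * t))) \<partial>(lborel :: 'a measure))"
      by (rule nn_integral_cmult) measurable
    also have "\<dots> = ennreal (?a * (t powr (?d / 2) * t ^ m)) * G"
      unfolding gaussian_moment_scaling[OF True] G_def
      by (subst ennreal_mult'[OF a]) (rule mult.assoc[symmetric])
    also have "?a * (t powr (?d / 2) * t ^ m) = t ^ m * ?I t"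
      using True by (simp add: powr_minus field_simps)
    finally show ?thesis by (simp add: mult.commute)
  qed
  have "(\<integral>\<^sup>+h. ennreal (norm h ^ (2 * m) * jump_kernel DIM('a) \<mu> (norm h)) \<partial>(lborel :: 'a measure))
      \<le> (\<integral>\<^sup>+h. c * (\<integral>\<^sup>+t. ennreal (?k h t) \<partial>lborel) \<partial>lborel)"
  proof (rule nn_integral_mono)
    fix h :: 'a
    let ?f = "\<lambda>t. ennreal (t powr (- ?d / 2) * exp (- (norm h)\<^sup>2 / (4 * t)) * ?I t)"
    have "ennreal (norm h ^ (2 * m) * jump_kernel DIM('a) \<mu> (norm h))
        \<le> ennreal (norm h ^ (2 * m)) * (c * (\<integral>\<^sup>+t. ?f t \<partial>lborel))"
      using jump_kernel_le_nn_integral[OF cB, of "DIM('a)" "norm h"]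
      by (simp add: ennreal_mult' mult_left_mono c_def)
    also have "\<dots> = c * (ennreal (norm h ^ (2 * m)) * (\<integral>\<^sup>+t. ?f t \<partial>lborel))"
      by (simp add: mult.left_commute)
    also have "ennreal (norm h ^ (2 * m)) * (\<integral>\<^sup>+t. ?f t \<partial>lborel)
        = (\<integral>\<^sup>+t. ennreal (norm h ^ (2 * m)) * ?f t \<partial>lborel)"
      by (rule nn_integral_cmult[symmetric]) measurable
    also have "\<dots> = (\<integral>\<^sup>+t. ennreal (?k h t) \<partial>lborel)"
      by (intro nn_integral_cong) (simp add: ennreal_mult')
    finally show "ennreal (norm h ^ (2 * m) * jump_kernel DIM('a) \<mu> (norm h))
        \<le> c * (\<integral>\<^sup>+t. ennreal (?k h t) \<partial>lborel)" .
  qed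
  also have "\<dots> = c * (\<integral>\<^sup>+h. (\<integral>\<^sup>+t. ennreal (?k h t) \<partial>lborel) \<partial>lborel)"
    by (rule nn_integral_cmult) measurable
  also have "(\<integral>\<^sup>+h. (\<integral>\<^sup>+t. ennreal (?k h t) \<partial>lborel) \<partial>lborel)
      = (\<integral>\<^sup>+t. (\<integral>\<^sup>+h. ennreal (?k h t) \<partial>lborel) \<partial>lborel)"
    by (rule lborel_pair.Fubini'[symmetric]) measurable
  also have "\<dots> = G * (\<integral>\<^sup>+t. ennreal (t ^ m * ?I t) \<partial>lborel)"
    unfolding inner by (rule nn_integral_cmult) measurable
  also have "c * \<dots> < \<infinity>"
    using fin gaussian_moment_finite[where 'a='a and n="2 * m"]
    by (simp add: c_def G_def ennreal_mult_less_top)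
  finally have "(\<integral>\<^sup>+h. ennreal (norm h ^ (2 * m) * jump_kernel DIM('a) \<mu> (norm h)) \<partial>(lborel :: 'a measure)) < \<infinity>" .
  then have "integrable lborel (\<lambda>h::'a. norm h ^ (2 * m) * jump_kernel DIM('a) \<mu> (norm h))"
    using jump_kernel_nonneg[OF cB] by (intro integrableI_nonneg) auto
  then show ?thesis by (subst integrable_completion) auto
qed

section \<open>Estimating the singular integral\<close>

text \<open>Needed for \<open>h \<mapsto> \<phi>(x + h)\<close> and \<open>h \<mapsto> \<phi>(x - h)\<close>: since \<open>\<phi>\<close> is only Lebesgue measurable and
  only essentially bounded, composing with these maps requires that they are measurable between
  the completed spaces and that they reflect null sets.\<close>

lemma lebesgue_affine_compose:
  fixes f :: "'a::euclidean_space \<Rightarrow> real"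
  assumes c: "c \<noteq> 0" and f: "f \<in> borel_measurable lebesgue"
  shows "(\<lambda>h. f (x + c *\<^sub>R h)) \<in> borel_measurable lebesgue"
    and "AE y in lebesgue. \<bar>f y\<bar> \<le> B \<Longrightarrow> AE h in lebesgue. \<bar>f (x + c *\<^sub>R h)\<bar> \<le> B"
proof -
  have T: "x + (\<Sum>j\<in>Basis. (c * (h \<bullet> j)) *\<^sub>R j) = x + c *\<^sub>R h" for h
    unfolding scaleR_scaleR[symmetric] scaleR_sum_right[symmetric] euclidean_representation ..
  have meas: "(\<lambda>h. x + c *\<^sub>R h) \<in> lebesgue \<rightarrow>\<^sub>M lebesgue"
    using lebesgue_affine_measurable[of "\<lambda>_. c" x] c by (simp add: T)
  from measurable_compose[OF meas f] show "(\<lambda>h. f (x + c *\<^sub>R h)) \<in> borel_measurable lebesgue" .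
  have eq: "lebesgue = density (distr lebesgue lebesgue (\<lambda>h. x + c *\<^sub>R h)) (\<lambda>_. ennreal (\<bar>c\<bar> ^ DIM('a)))"
    using lebesgue_affine_euclidean[of "\<lambda>_. c" x] c by (simp add: T)
  assume "AE y in lebesgue. \<bar>f y\<bar> \<le> B"
  then have "AE y in density (distr lebesgue lebesgue (\<lambda>h. x + c *\<^sub>R h)) (\<lambda>_. ennreal (\<bar>c\<bar> ^ DIM('a))). \<bar>f y\<bar> \<le> B"
    by (simp only: eq[symmetric])
  then have "AE y in distr lebesgue lebesgue (\<lambda>h. x + c *\<^sub>R h). \<bar>f y\<bar> \<le> B"
    using c by (subst (asm) AE_density) auto
  moreover have "{y \<in> space lebesgue. \<bar>f y\<bar> \<le> B} \<in> sets lebesgue"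
    using f by measurable
  ultimately show "AE h in lebesgue. \<bar>f (x + c *\<^sub>R h)\<bar> \<le> B"
    using AE_distr_iff[OF meas, of "\<lambda>y. \<bar>f y\<bar> \<le> B"] by simp
qed

text \<open>The splitting at radius \<open>\<rho>\<close>.  Both bounds are nonnegative, so their sum dominates
  \<open>\<bar>D\<^sub>hf(x)\<bar>\<close> for almost every \<open>h\<close>, which gives integrability and the estimate at once.\<close>

lemma second_diff_integral_bound:
  fixes f :: "'a::euclidean_space \<Rightarrow> real" and j :: "'a \<Rightarrow> real"
  assumes f: "f \<in> borel_measurable lebesgue" and B: "AE y in lebesgue. \<bar>f y\<bar> \<le> B" and B0: "0 \<le> B"
    and j: "\<And>h. 0 \<le> j h" "j \<in> borel_measurable borel"
    and P: "0 \<le> P" and \<rho>: "0 < \<rho>"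
    and near: "\<And>h. norm h < \<rho> \<Longrightarrow> \<bar>second_diff f h x\<bar> \<le> P * (norm h)\<^sup>2"
    and int: "integrable lebesgue (\<lambda>h. (norm h)\<^sup>2 * j h)"
      "integrable lebesgue (\<lambda>h. norm h ^ (2 * m) * j h)"
  shows "integrable lebesgue (\<lambda>h. second_diff f h x * j h)" (is ?int)
    and "\<bar>LINT h|lebesgue. second_diff f h x * j h\<bar> \<le> P * (LINT h|lebesgue. (norm h)\<^sup>2 * j h) +
      (2 * B + 2 * \<bar>f x\<bar>) / \<rho> ^ (2 * m) * (LINT h|lebesgue. norm h ^ (2 * m) * j h)"
proof -
  let ?Q = "(2 * B + 2 * \<bar>f x\<bar>) / \<rho> ^ (2 * m)"
  let ?g = "\<lambda>h. P * ((norm h)\<^sup>2 * j h) + ?Q * (norm h ^ (2 * m) * j h)"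
  have plus: "AE h in lebesgue. \<bar>f (x + h)\<bar> \<le> B"
    using lebesgue_affine_compose(2)[of 1 f B x, OF _ f B] by simp
  have minus: "AE h in lebesgue. \<bar>f (x - h)\<bar> \<le> B"
    using lebesgue_affine_compose(2)[of "-1" f B x, OF _ f B] by simp
  have [measurable]: "f \<in> borel_measurable lebesgue" "j \<in> borel_measurable lebesgue"
    using f j(2) by (auto intro: measurable_completion)
  have [measurable]: "(\<lambda>h. f (x + h)) \<in> borel_measurable lebesgue"
    "(\<lambda>h. f (x - h)) \<in> borel_measurable lebesgue"
    using lebesgue_affine_compose(1)[of 1 f x, OF _ f] lebesgue_affine_compose(1)[of "-1" f x, OF _ f]
    by simp_all
  have meas: "(\<lambda>h. second_diff f h x * j h) \<in> borel_measurable lebesgue"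
    unfolding second_diff_def by measurable
  have dom: "AE h in lebesgue. \<bar>second_diff f h x * j h\<bar> \<le> ?g h"
    using plus minus
  proof eventually_elim
    case (elim h)
    have "\<bar>second_diff f h x\<bar> \<le> P * (norm h)\<^sup>2 + ?Q * norm h ^ (2 * m)"
    proof (cases "norm h < \<rho>")
      case True
      then show ?thesis using near[OF True] B0 \<rho> by (simp add: add_increasing2)
    next
      case False
      then have "\<rho> ^ (2 * m) \<le> norm h ^ (2 * m)" using \<rho> by (intro power_mono) auto
      then have 1: "1 \<le> norm h ^ (2 * m) / \<rho> ^ (2 * m)" using \<rho> by simp
      have "\<bar>second_diff f h x\<bar> \<le> 2 * B + 2 * \<bar>f x\<bar>"
        using elim unfolding second_diff_def by linarith
      also have "\<dots> \<le> (2 * B + 2 * \<bar>f x\<bar>) * (norm h ^ (2 * m) / \<rho> ^ (2 * m))"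
        using mult_left_mono[OF 1, of "2 * B + 2 * \<bar>f x\<bar>"] B0 by simp
      finally show ?thesis using P by (simp add: add_increasing)
    qed
    then have "\<bar>second_diff f h x\<bar> * j h \<le> (P * (norm h)\<^sup>2 + ?Q * norm h ^ (2 * m)) * j h"
      using j(1) by (rule mult_right_mono)
    then show ?case using j(1)[of h] by (simp add: abs_mult algebra_simps)
  qed
  have g: "integrable lebesgue ?g"
    using int by (intro Bochner_Integration.integrable_add integrable_mult_right)
  show int': ?int
    using dom by (intro Bochner_Integration.integrable_bound[OF g meas]) auto
  have "\<bar>LINT h|lebesgue. second_diff f h x * j h\<bar> \<le> (LINT h|lebesgue. \<bar>second_diff f h x * j h\<bar>)"
    by (rule integral_abs_bound)
  also have "\<dots> \<le> (LINT h|lebesgue. ?g h)"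
    using int' g dom by (intro integral_mono_AE integrable_abs)
  also have "\<dots> = P * (LINT h|lebesgue. (norm h)\<^sup>2 * j h) + ?Q * (LINT h|lebesgue. norm h ^ (2 * m) * j h)"
    using int by simp
  finally show "\<bar>LINT h|lebesgue. second_diff f h x * j h\<bar> \<le> \<dots>" .
qed

section \<open>Decay of the potential\<close>

theorem theorem4p4:
  fixes \<Phi> \<mu> :: "real \<Rightarrow> real"
    and V \<phi> L\<^sub>\<phi> :: "'a::euclidean_space \<Rightarrow> real"
    and C\<^sub>1 C\<^sub>2 C\<^sub>3 C\<^sub>4 M\<^sub>1 M\<^sub>2 M\<^sub>\<phi> C\<^sub>\<mu> \<eta> \<alpha> \<kappa> :: real
  assumes "complete_Bernstein \<Phi> \<mu>"
    and "zero_energy_eigenfunction \<Phi> \<mu> V \<phi>"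
    and "0 < C\<^sub>1" "C\<^sub>1 < 1"
    and "\<phi> \<in> Z_space C\<^sub>1" and "Z_bound C\<^sub>1 \<phi> M\<^sub>\<phi> L\<^sub>\<phi>"
    and "0 < C\<^sub>\<mu>" "0 < \<eta>" "0 < \<alpha>" "\<alpha> \<le> 2"
    and "\<mu> \<sim>[at_top] (\<lambda>t. C\<^sub>\<mu> * t powr (- 1 - \<alpha> / 2) * exp (- (\<eta> * t)))"
    and "0 < C\<^sub>2" "0 < C\<^sub>3" "0 < M\<^sub>1" "0 < \<kappa>" "\<kappa> < (real DIM('a) + \<alpha>) / 2"
    and "\<forall>x \<in> - ball 0 M\<^sub>1. C\<^sub>2 * norm x powr (- 2 * \<kappa>) \<le> \<phi> x \<and> \<phi> x \<le> C\<^sub>3 * norm x powr (- 2 * \<kappa>)"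
    and "0 < M\<^sub>2" "0 < C\<^sub>4"
    and "\<forall>x \<in> - ball 0 M\<^sub>2. L\<^sub>\<phi> x \<le> C\<^sub>4 * norm x powr (- (2 * \<kappa> + 2))"
  shows "V \<in> O[at_infinity](\<lambda>x. norm x powr (- 2))"
proof -
  note cB = assms(1) and eig = assms(2)
  have pos: "0 < \<phi> x" for x using eig by (simp add: zero_energy_eigenfunction_def)
  have meas: "\<phi> \<in> borel_measurable lebesgue"
    using eig by (simp add: zero_energy_eigenfunction_def L2_def)
  obtain B where B: "AE x in lebesgue. \<bar>\<phi> x\<bar> \<le> B"
    using eig by (auto simp: zero_energy_eigenfunction_def Linfty_on_def AE_restrict_space_iff)
  obtain m :: nat where m: "\<kappa> + 1 \<le> real m"
    using real_arch_simple by blast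
  then have m1: "1 \<le> m" using \<open>0 < \<kappa>\<close> by linarith
  let ?j = "\<lambda>h::'a. jump_kernel DIM('a) \<mu> (norm h)"
  have moment: "integrable lebesgue (\<lambda>h. norm h ^ (2 * k) * ?j h)" if "1 \<le> k" for k
    using jump_kernel_even_moment[OF cB]
      Levy_density_moment_finite[OF cB \<open>0 < C\<^sub>\<mu>\<close> \<open>0 < \<eta>\<close> \<open>0 < \<alpha>\<close> assms(11) that] by blast
  define W1 where "W1 = (LINT h|lebesgue. (norm h)\<^sup>2 * ?j h)"
  define W where "W = (LINT h|lebesgue. norm h ^ (2 * m) * ?j h)"
  have W0: "0 \<le> W1" "0 \<le> W"
    unfolding W1_def W_def using jump_kernel_nonneg[OF cB] by (auto intro!: integral_nonneg)
  define E where "E = (2 * \<bar>B\<bar> + 2 * C\<^sub>3) / C\<^sub>1 ^ (2 * m)"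
  have E0: "0 \<le> E" using \<open>0 < C\<^sub>1\<close> \<open>0 < C\<^sub>3\<close> by (simp add: E_def)
  \<comment> \<open>The value \<open>1\<close> ensures that powers of \<open>\<bar>x\<bar>\<close> increase with the exponent when \<open>R \<le> \<bar>x\<bar>\<close>.\<close>
  define R where "R = Max {1, M\<^sub>1, M\<^sub>2, M\<^sub>\<phi>}"
  have "\<bar>V x\<bar> \<le> (C\<^sub>4 * W1 + E * W) / (2 * C\<^sub>2) * norm x powr (- 2)" if "R \<le> norm x" for x
  proof -
    let ?r = "norm x"
    have r: "1 \<le> ?r" "M\<^sub>1 \<le> ?r" "M\<^sub>2 \<le> ?r" "M\<^sub>\<phi> \<le> ?r" using that by (auto simp: R_def)
    let ?P = "C\<^sub>4 * ?r powr (- (2 * \<kappa> + 2))"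
    let ?LI = "LINT h|lebesgue. second_diff \<phi> h x * ?j h"
    have lower: "C\<^sub>2 * ?r powr (- 2 * \<kappa>) \<le> \<phi> x" and upper: "\<phi> x \<le> C\<^sub>3 * ?r powr (- 2 * \<kappa>)"
      using assms(17) r by auto
    have "?r powr (- 2 * \<kappa>) \<le> ?r powr 0" using r \<open>0 < \<kappa>\<close> by (intro powr_mono) auto
    then have "C\<^sub>3 * ?r powr (- 2 * \<kappa>) \<le> C\<^sub>3 * 1"
      using r \<open>0 < C\<^sub>3\<close> by (intro mult_left_mono) (auto split: if_splits)
    with upper have upper1: "\<phi> x \<le> C\<^sub>3" by simp
    have near: "\<bar>second_diff \<phi> h x\<bar> \<le> ?P * (norm h)\<^sup>2" if "norm h < C\<^sub>1 * ?r" for h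
    proof -
      have "\<bar>second_diff \<phi> h x\<bar> \<le> L\<^sub>\<phi> x * (norm h)\<^sup>2"
        using assms(6) r that by (simp add: Z_bound_def)
      also have "\<dots> \<le> ?P * (norm h)\<^sup>2"
        using assms(20) r by (intro mult_right_mono) auto
      finally show ?thesis .
    qed
    have P0: "0 \<le> ?P" using \<open>0 < C\<^sub>4\<close> by simp
    have jm: "?j \<in> borel_measurable borel"
      using jump_kernel_measurable[OF cB, of "DIM('a)", measurable] by measurable
    have \<rho>: "0 < C\<^sub>1 * ?r" using \<open>0 < C\<^sub>1\<close> r by (intro mult_pos_pos) auto
    have B': "AE x in lebesgue. \<bar>\<phi> x\<bar> \<le> \<bar>B\<bar>" using B by eventually_elim simp
    have m2: "integrable lebesgue (\<lambda>h. (norm h)\<^sup>2 * ?j h)" using moment[of 1] by simp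
    note bnd = second_diff_integral_bound[OF meas B' abs_ge_zero jump_kernel_nonneg[OF cB] jm P0 \<rho> near m2 moment[OF m1]]
    have tail: "(2 * \<bar>B\<bar> + 2 * \<bar>\<phi> x\<bar>) / (C\<^sub>1 * ?r) ^ (2 * m) \<le> E * ?r powr (- (2 * \<kappa> + 2))"
    proof -
      have "(2 * \<bar>B\<bar> + 2 * \<bar>\<phi> x\<bar>) / (C\<^sub>1 * ?r) ^ (2 * m) \<le> (2 * \<bar>B\<bar> + 2 * C\<^sub>3) / (C\<^sub>1 * ?r) ^ (2 * m)"
        using upper1 pos[of x] \<rho> by (intro divide_right_mono) auto
      also have "\<dots> = E * ?r powr (- real (2 * m))"
        using r by (subst powr_minus, subst powr_realpow) (auto simp: E_def power_mult_distrib divide_simps)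
      also have "\<dots> \<le> E * ?r powr (- (2 * \<kappa> + 2))"
        using E0 r m by (intro mult_left_mono powr_mono) auto
      finally show ?thesis .
    qed
    have "\<bar>?LI\<bar> \<le> ?P * W1 + (2 * \<bar>B\<bar> + 2 * \<bar>\<phi> x\<bar>) / (C\<^sub>1 * ?r) ^ (2 * m) * W"
      using bnd(2) by (simp only: W1_def W_def)
    also have "\<dots> \<le> ?P * W1 + (E * ?r powr (- (2 * \<kappa> + 2))) * W"
      using tail W0 by (intro add_left_mono mult_right_mono)
    also have "\<dots> = (C\<^sub>4 * W1 + E * W) * ?r powr (- (2 * \<kappa> + 2))"
      by (simp add: algebra_simps)
    finally have LI: "\<bar>?LI\<bar> \<le> (C\<^sub>4 * W1 + E * W) * ?r powr (- (2 * \<kappa> + 2))" .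
    have "V x = 1 / (2 * \<phi> x) * ?LI"
      using eig bnd(1) by (simp add: zero_energy_eigenfunction_def)
    then have "\<bar>V x\<bar> = \<bar>?LI\<bar> / (2 * \<phi> x)"
      using pos[of x] by (simp add: abs_mult)
    also have "\<dots> \<le> ((C\<^sub>4 * W1 + E * W) * ?r powr (- (2 * \<kappa> + 2))) / (2 * (C\<^sub>2 * ?r powr (- 2 * \<kappa>)))"
      using LI lower pos[of x] \<open>0 < C\<^sub>2\<close> \<open>0 < C\<^sub>4\<close> E0 W0 r
      by (intro frac_le) (auto intro!: mult_nonneg_nonneg add_nonneg_nonneg mult_pos_pos)
    also have "\<dots> = (C\<^sub>4 * W1 + E * W) / (2 * C\<^sub>2) * (?r powr (- (2 * \<kappa> + 2)) / ?r powr (- 2 * \<kappa>))"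
      by simp
    also have "?r powr (- (2 * \<kappa> + 2)) / ?r powr (- 2 * \<kappa>) = ?r powr (- 2)"
      using r by (subst powr_diff[symmetric]) auto
    finally show ?thesis .
  qed
  then show ?thesis
    by (intro bigoI[where c="(C\<^sub>4 * W1 + E * W) / (2 * C\<^sub>2)"])
       (auto simp: eventually_at_infinity)
qed

end
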